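(* There is an absolute constant $c>0$ such that the following holds. Fix an integer $k\geq 1$, a constant $z\geq 1$, and an error parameter $\varepsilon\in(0,1)$ with $\varepsilon \geq c\, k^{-1/(z+2)}$. Then there exists a finite instance $P\subset \mathbb{R}^d$ (for some dimension $d \geq \Omega(k\varepsilon^{-z})$) such that every $\varepsilon$-coreset of $P$ for $(k,z)$-Clustering in $\mathbb{R}^d$ has size at least $\Omega(k\varepsilon^{-z-2})$.
   Context: For a metric space $(\mathcal{X},d)$, a finite dataset $P\subseteq\mathcal{X}$, $z\geq1$ and a set $C\subseteq\mathcal{X}$ of $k$ points (a center set), define $\mathrm{cost}_z(P,C)=\sum_{x\in P} d(x,C)^z$ where $d(x,C)=\min_{c\in C}d(x,c)$. An $\varepsilon$-coreset of $P$ for $(k,z)$-Clustering is a subset $S\subseteq P$ with weights $w:S\to\mathbb{R}_{\geq 0}$ such that for every $C\in\mathcal{X}^k$, $\sum_{x\in S} w(x)\, d(x,C)^z \in (1\pm\varepsilon)\,\mathrm{cost}_z(P,C)$. Its size is $|S|$. Here $\mathcal{X}=\mathbb{R}^d$ with the Euclidean distance. Asymptotic notation hides constants that may depend on $z$. *)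

theory Defs
  imports "HOL-Analysis.Analysis"
begin

text \<open>The dimension is quantified inside the statement, so \<open>\<real>\<^sup>n\<close> is the set
  \<open>topspace (Euclidean_space n)\<close> of sequences vanishing from index \<open>n\<close> on, with the metric below.\<close>

definition euclid_dist :: "nat \<Rightarrow> (nat \<Rightarrow> real) \<Rightarrow> (nat \<Rightarrow> real) \<Rightarrow> real" where
  "euclid_dist n x y = L2_set (\<lambda>i. x i - y i) {..<n}"

lemma Metric_space_euclid_dist:
  "Metric_space (topspace (Euclidean_space n)) (euclid_dist n)"
proof
  fix x y :: "nat \<Rightarrow> real"
  show "0 \<le> euclid_dist n x y"
    by (simp add: euclid_dist_def)
  show "euclid_dist n x y = euclid_dist n y x"
    by (simp add: euclid_dist_def L2_set_def power2_commute)
next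
  fix x y :: "nat \<Rightarrow> real"
  assume "x \<in> topspace (Euclidean_space n)" "y \<in> topspace (Euclidean_space n)"
  then have "x i = y i" if "i \<ge> n" for i
    using that by (simp add: topspace_Euclidean_space)
  then show "euclid_dist n x y = 0 \<longleftrightarrow> x = y"
    by (auto simp: euclid_dist_def L2_set_eq_0_iff fun_eq_iff) (metis lessThan_iff not_less)
next
  fix x y z :: "nat \<Rightarrow> real"
  show "euclid_dist n x z \<le> euclid_dist n x y + euclid_dist n y z"
    using L2_set_triangle_ineq[of "\<lambda>i. x i - y i" "\<lambda>i. y i - z i" "{..<n}"]
    by (simp add: euclid_dist_def)
qed

text \<open>In what follows \<open>X\<close> is the carrier and \<open>d\<close> the distance of a metric space.
  Center sets come from \<open>k\<close>-tuples in \<open>X\<close>, so repeated centers are allowed.\<close>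

definition center_sets :: "'a set \<Rightarrow> nat \<Rightarrow> 'a set set" where
  "center_sets X k = {set cs | cs. length cs = k \<and> set cs \<subseteq> X}"

definition dist_to_set :: "('a \<Rightarrow> 'a \<Rightarrow> real) \<Rightarrow> 'a \<Rightarrow> 'a set \<Rightarrow> real" where
  "dist_to_set d x C = Min ((\<lambda>c. d x c) ` C)"

definition clustering_cost ::
    "('a \<Rightarrow> 'a \<Rightarrow> real) \<Rightarrow> real \<Rightarrow> 'a set \<Rightarrow> 'a set \<Rightarrow> real" where
  "clustering_cost d z P C = (\<Sum>x\<in>P. dist_to_set d x C powr z)"

definition is_coreset ::
    "'a set \<Rightarrow> ('a \<Rightarrow> 'a \<Rightarrow> real) \<Rightarrow> nat \<Rightarrow> real \<Rightarrow> real \<Rightarrow> 'a set \<Rightarrow> 'a set \<Rightarrow> ('a \<Rightarrow> real) \<Rightarrow> bool" where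
  "is_coreset X d k z \<epsilon> P S w \<longleftrightarrow>
     S \<subseteq> P \<and> (\<forall>x\<in>S. 0 \<le> w x) \<and>
     (\<forall>C\<in>center_sets X k.
        (\<Sum>x\<in>S. w x * dist_to_set d x C powr z)
          \<in> {(1 - \<epsilon>) * clustering_cost d z P C .. (1 + \<epsilon>) * clustering_cost d z P C})"

end

theory Submission
  imports Defs
begin

text \<open>For \<open>\<epsilon>\<close> bounded away from \<open>0\<close> a coreset with at most \<open>k\<close> points would have weighted cost
  \<open>0\<close> for the center set consisting of the coreset itself, so more than \<open>k\<close> points are needed.

  For small \<open>\<epsilon>\<close> let \<open>R\<close> be of order \<open>1 / \<epsilon>\<close> and take the points \<open>R u\<^sub>i + e\<^sub>j\<close> with \<open>i < m\<close>, \<open>j < s\<close>,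
  where the \<open>u\<^sub>i\<close> and \<open>e\<^sub>j\<close> are orthonormal, \<open>m\<close> is of order \<open>k\<close> and \<open>s\<close> of order \<open>\<epsilon>\<^bsup>-z-2\<^esup>\<close>.
  The centers \<open>R u\<^sub>i\<close> serve every point at distance \<open>1\<close>. Remove them for a set \<open>U\<close> of about
  \<open>R\<^bsup>-z\<^esup> m\<close> of the indices \<open>i\<close> (rows), and cover \<open>U\<close> by sets of about \<open>R\<^sup>2\<close> rows. For each such set and each \<open>j\<close>
  there is room for one further center of norm \<open>R\<close> that has coordinate \<open>R / 2\<close> at \<open>e\<^sub>j\<close> and
  coordinate \<open>1 / 2\<close> at arbitrarily chosen \<open>u\<^sub>i\<close> of the set. Hence for an arbitrary set \<open>T\<close> of
  the points that lost their center one can lower the costs on \<open>T\<close>, and only there, by a relative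
  amount of order \<open>1 / R\<close>, while these points carry a constant fraction of the total cost.
  Taking for \<open>T\<close> the points outside the coreset changes the true cost but not the estimate, so
  \<open>T\<close> is small. As \<open>U\<close> was arbitrary, all but few rows consist mostly of coreset points.\<close>

section \<open>Coresets in metric spaces\<close>

lemma center_setsI:
  assumes "finite C" "C \<noteq> {}" "card C \<le> k" "C \<subseteq> X"
  shows "C \<in> center_sets X k"
proof -
  obtain xs where xs: "set xs = C" "length xs = card C"
    using assms(1) finite_distinct_list distinct_card by metis
  obtain c where "c \<in> C" using assms(2) by blast
  then have "set (xs @ replicate (k - card C) c) = C" "length (xs @ replicate (k - card C) c) = k"
    using xs assms(3) by auto
  then show ?thesis unfolding center_sets_def using assms(4) by blast
qed

lemma dist_to_set_eqI:
  assumes "finite C" "c \<in> C" "\<And>c'. c' \<in> C \<Longrightarrow> d x c \<le> d x c'"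
  shows "dist_to_set d x C = d x c"
  unfolding dist_to_set_def using assms by (intro Min_eqI) auto

lemma clustering_cost_nonneg: "0 \<le> clustering_cost d z P C"
  by (simp add: clustering_cost_def sum_nonneg)

lemma (in Metric_space) dist_to_set_eq_0_iff:
  assumes "finite C" "C \<noteq> {}" "C \<subseteq> M" "x \<in> M"
  shows "dist_to_set d x C = 0 \<longleftrightarrow> x \<in> C"
proof
  have "dist_to_set d x C \<in> d x ` C"
    unfolding dist_to_set_def using assms by (intro Min_in) auto
  moreover assume "dist_to_set d x C = 0"
  ultimately obtain c where "c \<in> C" "d x c = 0" by auto
  then show "x \<in> C" using assms zero by auto
next
  assume "x \<in> C"
  then show "dist_to_set d x C = 0"
    using dist_to_set_eqI[of C x d x] assms mdist_zero by simp
qed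

lemma (in Metric_space) clustering_cost_eq_0_iff:
  assumes "finite C" "C \<noteq> {}" "C \<subseteq> M" "finite P" "P \<subseteq> M"
  shows "clustering_cost d z P C = 0 \<longleftrightarrow> P \<subseteq> C"
proof -
  have "clustering_cost d z P C = 0 \<longleftrightarrow> (\<forall>x\<in>P. dist_to_set d x C = 0)"
    unfolding clustering_cost_def using assms(4) by (subst sum_nonneg_eq_0_iff) auto
  also have "\<dots> \<longleftrightarrow> P \<subseteq> C"
    using assms dist_to_set_eq_0_iff[OF assms(1-3)] by auto
  finally show ?thesis .
qed

lemma (in Metric_space) coreset_card_gt:
  assumes cs: "is_coreset M d k z \<epsilon> P S w" and P: "finite P" "P \<subseteq> M" "k < card P"
    and k: "1 \<le> k" and \<epsilon>: "\<epsilon> < 1"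
  shows "k < card S"
proof (rule ccontr)
  assume "\<not> k < card S"
  then have card_S: "card S \<le> k" by simp
  have S: "S \<subseteq> P" "finite S" using cs P(1) finite_subset by (auto simp: is_coreset_def)
  obtain p where "p \<in> P" using P(3) by fastforce
  define C where "C = (if S = {} then {p} else S)"
  have C: "finite C" "C \<noteq> {}" "card C \<le> k" "C \<subseteq> M" and "S \<subseteq> C"
    using S card_S k P \<open>p \<in> P\<close> by (auto simp: C_def)
  have "dist_to_set d x C = 0" if "x \<in> S" for x
    using that dist_to_set_eq_0_iff[OF C(1,2,4)] \<open>S \<subseteq> C\<close> \<open>C \<subseteq> M\<close> by blast
  then have "(\<Sum>x\<in>S. w x * dist_to_set d x C powr z) = 0" by simp
  then have "(1 - \<epsilon>) * clustering_cost d z P C \<le> 0"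
    using cs center_setsI[OF C] unfolding is_coreset_def by (metis atLeastAtMost_iff)
  then have "clustering_cost d z P C = 0"
    using \<epsilon> clustering_cost_nonneg[of d z P C] by (simp add: mult_le_0_iff)
  then have "P \<subseteq> C" using clustering_cost_eq_0_iff C P by blast
  then have "card P \<le> card C" using C(1) by (intro card_mono)
  then show False using C(3) P(3) by simp
qed

lemma coreset_cost_diff_le:
  assumes cs: "is_coreset X d k z \<epsilon> P S w" and C: "C \<in> center_sets X k" "C' \<in> center_sets X k"
    and same: "\<And>x. x \<in> S \<Longrightarrow> dist_to_set d x C = dist_to_set d x C'" and \<epsilon>: "0 \<le> \<epsilon>"
  shows "clustering_cost d z P C - clustering_cost d z P C' \<le> 2 * \<epsilon> * clustering_cost d z P C"
proof (cases "clustering_cost d z P C \<le> clustering_cost d z P C'")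
  case True
  moreover have "0 \<le> 2 * \<epsilon> * clustering_cost d z P C"
    using \<epsilon> clustering_cost_nonneg by (intro mult_nonneg_nonneg) auto
  ultimately show ?thesis by simp
next
  case False
  let ?diff = "clustering_cost d z P C - clustering_cost d z P C'"
  have "(1 - \<epsilon>) * clustering_cost d z P C \<le> (\<Sum>x\<in>S. w x * dist_to_set d x C powr z)"
    using cs C by (auto simp: is_coreset_def)
  also have "\<dots> = (\<Sum>x\<in>S. w x * dist_to_set d x C' powr z)"
    using same by simp
  also have "\<dots> \<le> (1 + \<epsilon>) * clustering_cost d z P C'"
    using cs C by (auto simp: is_coreset_def)
  finally have "(1 + \<epsilon>) * ?diff \<le> 2 * \<epsilon> * clustering_cost d z P C"
    by (simp add: algebra_simps)
  moreover have "1 * ?diff \<le> (1 + \<epsilon>) * ?diff"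
    using False \<epsilon> by (intro mult_right_mono) auto
  ultimately show ?thesis by simp
qed

section \<open>Covers by small sets and averaging\<close>

lemma ex_cover_card_le:
  assumes "finite U" "0 < L"
  obtains \<G> where "finite \<G>" "\<Union>\<G> = U" "\<And>F. F \<in> \<G> \<Longrightarrow> card F \<le> L" "card \<G> \<le> card U div L + 1"
proof -
  obtain h where h: "bij_betw h {0..<card U} U"
    using ex_bij_betw_nat_finite[OF assms(1)] by blast
  define slice where "slice q = {i. i < card U \<and> i div L = q}" for q
  define \<G> where "\<G> = (\<lambda>q. h ` slice q) ` {..card U div L}"
  have "finite \<G>" by (simp add: \<G>_def)
  moreover have "\<Union>\<G> = h ` {0..<card U}"
    unfolding \<G>_def slice_def using div_le_mono[of _ "card U" L] by fastforce
  then have "\<Union>\<G> = U" using h by (simp add: bij_betw_def)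
  moreover have "card F \<le> L" if F: "F \<in> \<G>" for F
  proof -
    obtain q where q: "F = h ` slice q" using F unfolding \<G>_def by blast
    have "slice q \<subseteq> {q * L..<q * L + L}"
      using dividend_less_div_times[OF assms(2)]
      by (auto simp: slice_def div_times_less_eq_dividend add.commute)
    then have "card (slice q) \<le> L" using card_mono[of "{q * L..<q * L + L}"] by fastforce
    moreover have "card F \<le> card (slice q)"
      unfolding q by (rule card_image_le) (simp add: slice_def)
    ultimately show ?thesis by simp
  qed
  moreover have "card \<G> \<le> card {..card U div L}"
    unfolding \<G>_def by (rule card_image_le) simp
  then have "card \<G> \<le> card U div L + 1" by simp
  ultimately show ?thesis by (rule that)
qed

lemma sum_ge_if_subset_sums_ge:
  fixes f :: "'a \<Rightarrow> real"
  assumes "finite I" and nonneg: "\<And>i. i \<in> I \<Longrightarrow> 0 \<le> f i" and "0 < u" "0 \<le> c"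
    and subset_sums: "\<And>U. U \<subseteq> I \<Longrightarrow> card U = u \<Longrightarrow> c * real u \<le> sum f U"
  shows "c * (real (card I) - real u) \<le> sum f I"
proof -
  define small where "small = {i \<in> I. f i < c}"
  have small: "small \<subseteq> I" "finite small" using assms(1) by (auto simp: small_def)
  have "card small < u"
  proof (rule ccontr)
    assume "\<not> card small < u"
    then obtain U where U: "U \<subseteq> small" "card U = u" "finite U"
      by (meson not_less obtain_subset_with_card_n)
    have "U \<noteq> {}" using U(2) \<open>0 < u\<close> by auto
    then have "sum f U < sum (\<lambda>_. c) U"
      using U by (intro sum_strict_mono) (auto simp: small_def)
    moreover have "c * real u \<le> sum f U"
      using subset_sums U small by blast
    ultimately show False using U(2) by (simp add: mult.commute)
  qed
  then have "real (card I) - real u \<le> real (card (I - small))"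
    using small by (simp add: card_Diff_subset of_nat_diff card_mono[OF \<open>finite I\<close>])
  then have "c * (real (card I) - real u) \<le> sum (\<lambda>_. c) (I - small)"
    using \<open>0 \<le> c\<close> by (simp add: mult.commute mult_left_mono)
  also have "\<dots> \<le> sum f (I - small)"
    by (rule sum_mono) (auto simp: small_def)
  also have "\<dots> \<le> sum f I"
    using assms(1) nonneg by (intro sum_mono2) auto
  finally show ?thesis .
qed

section \<open>The grid of points and its center sets\<close>

locale grid_instance =
  fixes R :: real and m s n :: nat
  assumes R_ge_1: "1 \<le> R" and rows_pos: "0 < m" and columns_pos: "0 < s" and dimension: "m + s < n"
begin

definition grid :: "(nat \<times> nat) set" where
  "grid = {..<m} \<times> {..<s}"

definition grid_point :: "nat \<times> nat \<Rightarrow> nat \<Rightarrow> real" where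
  "grid_point = (\<lambda>(i, j) x. if x = i then R else if x = m + j then 1 else 0)"

definition near_center :: "nat \<Rightarrow> nat \<Rightarrow> real" where
  "near_center i x = (if x = i then R else 0)"

text \<open>The last coordinate only serves to make the norm equal to \<open>R\<close>, whatever \<open>F\<close> is.\<close>

definition far_center :: "nat set \<Rightarrow> nat \<Rightarrow> nat \<Rightarrow> real" where
  "far_center F j x = (if x \<in> F then 1 / 2 else if x = m + j then R / 2
     else if x = m + s then sqrt (3 * R\<^sup>2 / 4 - real (card F) / 4) else 0)"

definition centers :: "nat set set \<Rightarrow> (nat \<times> nat) set \<Rightarrow> (nat \<Rightarrow> real) set" where
  "centers \<G> T = near_center ` ({..<m} - \<Union>\<G>)
     \<union> (\<lambda>(F, j). far_center {i \<in> F. (i, j) \<in> T} j) ` (\<G> \<times> {..<s})"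

abbreviation grid_cost :: "real \<Rightarrow> (nat \<Rightarrow> real) set \<Rightarrow> real" where
  "grid_cost z \<equiv> clustering_cost (euclid_dist n) z (grid_point ` grid)"

definition small_row_sets :: "nat set set \<Rightarrow> bool" where
  "small_row_sets \<G> \<longleftrightarrow> finite \<G> \<and> (\<forall>F\<in>\<G>. F \<subseteq> {..<m} \<and> real (card F) \<le> 3 * R\<^sup>2)"

definition far_dist :: real where
  "far_dist = sqrt (2 * R\<^sup>2 + 1 - R)"

definition lowered_dist :: real where
  "lowered_dist = sqrt (2 * R\<^sup>2 + 1 - 2 * R)"

definition grid_dist :: "nat set \<Rightarrow> (nat \<times> nat) set \<Rightarrow> nat \<times> nat \<Rightarrow> real" where
  "grid_dist U T p = (if fst p \<notin> U then 1 else if p \<in> T then lowered_dist else far_dist)"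

lemma finite_grid: "finite grid"
  by (simp add: grid_def)

lemma R_le_R_squared: "R \<le> R\<^sup>2"
  using R_ge_1 by (simp add: power2_eq_square)

lemma inj_on_grid_point: "inj_on grid_point grid"
proof (rule inj_onI)
  fix p q assume pq: "p \<in> grid" "q \<in> grid" and eq: "grid_point p = grid_point q"
  obtain i j i' j' where [simp]: "p = (i, j)" "q = (i', j')" by (metis surj_pair)
  have "grid_point p i = grid_point q i" "grid_point p (m + j) = grid_point q (m + j)"
    using eq by simp_all
  then show "p = q" using pq R_ge_1 by (auto simp: grid_point_def grid_def split: if_splits)
qed

lemma grid_point_in_space: "p \<in> grid \<Longrightarrow> grid_point p \<in> topspace (Euclidean_space n)"
  using dimension by (auto simp: grid_point_def grid_def topspace_Euclidean_space)

lemma norm_near_center: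
  assumes "i < m"
  shows "(\<Sum>x<n. (near_center i x)\<^sup>2) = R\<^sup>2"
proof -
  have "(\<Sum>x<n. (near_center i x)\<^sup>2) = (\<Sum>x<n. if x = i then R\<^sup>2 else 0)"
    by (intro sum.cong) (auto simp: near_center_def)
  then show ?thesis using assms dimension by simp
qed

lemma norm_far_center:
  assumes "j < s" and F: "F \<subseteq> {..<m}" "real (card F) \<le> 3 * R\<^sup>2"
  shows "(\<Sum>x<n. (far_center F j x)\<^sup>2) = R\<^sup>2"
proof -
  let ?v = "3 * R\<^sup>2 / 4 - real (card F) / 4"
  have "(\<Sum>x<n. (far_center F j x)\<^sup>2) = (\<Sum>x<n. (if x \<in> F then 1 / 4 else 0)
      + (if x = m + j then R\<^sup>2 / 4 else 0) + (if x = m + s then ?v else 0))"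
    using assms by (intro sum.cong) (auto simp: far_center_def power_divide)
  also have "\<dots> = (\<Sum>x<n. if x \<in> F then 1 / 4 else 0) + R\<^sup>2 / 4 + ?v"
    using assms dimension by (simp add: sum.distrib)
  also have "(\<Sum>x<n. if x \<in> F then 1 / 4 else 0 :: real) = (\<Sum>x\<in>F. 1 / 4)"
    using F(1) dimension by (intro sum.mono_neutral_cong_right) auto
  finally show ?thesis by simp
qed

lemma euclid_dist_grid_point:
  assumes "i < m" "j < s" and norm_c: "(\<Sum>x<n. (c x)\<^sup>2) = R\<^sup>2"
  shows "euclid_dist n (grid_point (i, j)) c = sqrt (2 * R\<^sup>2 + 1 - 2 * R * c i - 2 * c (m + j))"
proof -
  have "(\<Sum>x<n. (grid_point (i, j) x - c x)\<^sup>2)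
      = (\<Sum>x<n. (c x)\<^sup>2 + (if x = i then R\<^sup>2 - 2 * R * c i else 0)
          + (if x = m + j then 1 - 2 * c (m + j) else 0))"
    using assms by (intro sum.cong) (auto simp: grid_point_def power2_eq_square algebra_simps)
  also have "\<dots> = R\<^sup>2 + (R\<^sup>2 - 2 * R * c i) + (1 - 2 * c (m + j))"
    using assms dimension by (simp add: sum.distrib)
  finally show ?thesis by (simp add: euclid_dist_def L2_set_def algebra_simps)
qed

lemma euclid_dist_near_center:
  assumes "i < m" "j < s" "i' < m"
  shows "euclid_dist n (grid_point (i, j)) (near_center i') = (if i = i' then 1 else sqrt (2 * R\<^sup>2 + 1))"
  using assms
  by (simp add: euclid_dist_grid_point norm_near_center) (simp add: near_center_def power2_eq_square)

lemma euclid_dist_far_center: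
  assumes "i < m" "j < s" "j' < s" "F \<subseteq> {..<m}" "real (card F) \<le> 3 * R\<^sup>2"
  shows "euclid_dist n (grid_point (i, j)) (far_center F j')
    = sqrt (2 * R\<^sup>2 + 1 - (if i \<in> F then R else 0) - (if j = j' then R else 0))"
proof -
  have "far_center F j' i = (if i \<in> F then 1 / 2 else 0)"
    using assms by (simp add: far_center_def)
  moreover have "far_center F j' (m + j) = (if j = j' then R / 2 else 0)"
    using assms by (auto simp: far_center_def)
  ultimately show ?thesis
    using assms by (simp add: euclid_dist_grid_point norm_far_center)
qed

lemma euclid_dist_far_center_restrict:
  assumes "small_row_sets \<G>" "F \<in> \<G>" and ij: "i < m" "j < s" "j' < s"
  shows "euclid_dist n (grid_point (i, j)) (far_center {i \<in> F. (i, j') \<in> T} j')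
    = sqrt (2 * R\<^sup>2 + 1 - (if i \<in> F \<and> (i, j') \<in> T then R else 0) - (if j = j' then R else 0))"
proof -
  have F: "F \<subseteq> {..<m}" "real (card F) \<le> 3 * R\<^sup>2"
    using assms(1,2) by (auto simp: small_row_sets_def)
  then have "card {i \<in> F. (i, j') \<in> T} \<le> card F"
    by (intro card_mono) (auto intro: finite_subset)
  then show ?thesis using F ij by (subst euclid_dist_far_center) auto
qed

lemma grid_dist_attained:
  assumes \<G>: "small_row_sets \<G>" and p: "p \<in> grid"
  shows "\<exists>c\<in>centers \<G> T. euclid_dist n (grid_point p) c = grid_dist (\<Union>\<G>) T p"
proof -
  obtain i j where p_eq: "p = (i, j)" and ij: "i < m" "j < s" using p by (auto simp: grid_def)
  show ?thesis
  proof (cases "i \<in> \<Union>\<G>")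
    case True
    then obtain F where F: "F \<in> \<G>" "i \<in> F" by blast
    then have "far_center {i \<in> F. (i, j) \<in> T} j \<in> centers \<G> T"
      using ij by (auto simp: centers_def)
    moreover have "euclid_dist n (grid_point p) (far_center {i \<in> F. (i, j) \<in> T} j)
        = grid_dist (\<Union>\<G>) T p"
      unfolding p_eq euclid_dist_far_center_restrict[OF \<G> F(1) ij ij(2)] using F
      by (auto simp: grid_dist_def lowered_dist_def far_dist_def)
    ultimately show ?thesis by blast
  next
    case False
    then have "near_center i \<in> centers \<G> T"
      using ij by (auto simp: centers_def)
    moreover have "euclid_dist n (grid_point p) (near_center i) = grid_dist (\<Union>\<G>) T p"
      using False ij by (simp add: p_eq euclid_dist_near_center grid_dist_def)
    ultimately show ?thesis by blast
  qed
qed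

lemma grid_dist_le:
  assumes \<G>: "small_row_sets \<G>" and p: "p \<in> grid" and c: "c \<in> centers \<G> T"
  shows "grid_dist (\<Union>\<G>) T p \<le> euclid_dist n (grid_point p) c"
proof -
  obtain i j where p_eq: "p = (i, j)" and ij: "i < m" "j < s" using p by (auto simp: grid_def)
  show ?thesis using c unfolding centers_def
  proof
    assume "c \<in> near_center ` ({..<m} - \<Union>\<G>)"
    then show ?thesis
      using ij R_ge_1
      by (auto simp: p_eq euclid_dist_near_center grid_dist_def lowered_dist_def far_dist_def)
  next
    assume "c \<in> (\<lambda>(F, j). far_center {i \<in> F. (i, j) \<in> T} j) ` (\<G> \<times> {..<s})"
    then obtain F j' where "F \<in> \<G>" "j' < s" "c = far_center {i \<in> F. (i, j') \<in> T} j'" by auto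
    then show ?thesis
      using ij R_ge_1 R_le_R_squared
      by (auto simp: p_eq euclid_dist_far_center_restrict[OF \<G>] grid_dist_def
          lowered_dist_def far_dist_def)
  qed
qed

lemma finite_centers: "small_row_sets \<G> \<Longrightarrow> finite (centers \<G> T)"
  by (simp add: centers_def small_row_sets_def)

lemma dist_to_centers:
  assumes "small_row_sets \<G>" "p \<in> grid"
  shows "dist_to_set (euclid_dist n) (grid_point p) (centers \<G> T) = grid_dist (\<Union>\<G>) T p"
proof -
  obtain c where c: "c \<in> centers \<G> T" "euclid_dist n (grid_point p) c = grid_dist (\<Union>\<G>) T p"
    using grid_dist_attained[OF assms] by blast
  then have "dist_to_set (euclid_dist n) (grid_point p) (centers \<G> T)
      = euclid_dist n (grid_point p) c"
    using grid_dist_le[OF assms] finite_centers[OF assms(1)] by (intro dist_to_set_eqI) auto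
  then show ?thesis using c(2) by simp
qed

lemma centers_in_center_sets:
  assumes \<G>: "small_row_sets \<G>" and card: "m + card \<G> * s \<le> k"
  shows "centers \<G> T \<in> center_sets (topspace (Euclidean_space n)) k"
proof (rule center_setsI)
  show "finite (centers \<G> T)" by (rule finite_centers[OF \<G>])
  show "centers \<G> T \<noteq> {}"
    using rows_pos columns_pos by (cases "0 \<in> \<Union>\<G>") (auto simp: centers_def)
  have "card (centers \<G> T) \<le> card ({..<m} - \<Union>\<G>) + card (\<G> \<times> {..<s})"
    unfolding centers_def using \<G>
    by (intro order_trans[OF card_Un_le] add_mono card_image_le) (auto simp: small_row_sets_def)
  also have "\<dots> \<le> m + card \<G> * s"
    using card_mono[of "{..<m}" "{..<m} - \<Union>\<G>"] by (simp add: card_cartesian_product)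
  finally show "card (centers \<G> T) \<le> k" using card by simp
  show "centers \<G> T \<subseteq> topspace (Euclidean_space n)"
    using \<G> dimension
    by (force simp: small_row_sets_def centers_def near_center_def far_center_def
        topspace_Euclidean_space)
qed

lemma ex_center_set_grid_dist:
  assumes U: "U \<subseteq> {..<m}" and budget: "real m + (real (card U) / R\<^sup>2 + 1) * real s \<le> real k"
  obtains C where "C \<in> center_sets (topspace (Euclidean_space n)) k"
    "\<And>p. p \<in> grid \<Longrightarrow> dist_to_set (euclid_dist n) (grid_point p) C = grid_dist U T p"
proof -
  define L where "L = nat \<lceil>R\<^sup>2\<rceil>"
  have R2: "1 \<le> R\<^sup>2" using R_ge_1 R_le_R_squared by linarith
  have L: "R\<^sup>2 \<le> real L" "real L \<le> 3 * R\<^sup>2" "0 < L"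
    using R2 unfolding L_def by linarith+
  have "finite U" using U finite_subset by blast
  then obtain \<G> where \<G>: "finite \<G>" "\<Union>\<G> = U" "\<And>F. F \<in> \<G> \<Longrightarrow> card F \<le> L"
      "card \<G> \<le> card U div L + 1"
    using ex_cover_card_le L(3) by metis
  have "real (card \<G>) \<le> real (card U div L) + 1" using \<G>(4) by linarith
  also have "real (card U div L) \<le> real (card U) / real L"
    by (rule of_nat_div_le_of_nat)
  also have "\<dots> \<le> real (card U) / R\<^sup>2"
    using L R2 by (intro divide_left_mono mult_pos_pos) auto
  finally have "real m + real (card \<G>) * real s \<le> real m + (real (card U) / R\<^sup>2 + 1) * real s"
    by (intro add_left_mono mult_right_mono) auto
  then have "real (m + card \<G> * s) \<le> real k" using budget by simp
  then have "m + card \<G> * s \<le> k" by (simp only: of_nat_le_iff)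
  moreover have small: "small_row_sets \<G>"
    unfolding small_row_sets_def
  proof (intro conjI ballI)
    fix F assume F: "F \<in> \<G>"
    show "F \<subseteq> {..<m}" using F \<G>(2) U by blast
    show "real (card F) \<le> 3 * R\<^sup>2" using \<G>(3)[OF F] L(2) by linarith
  qed (rule \<G>(1))
  ultimately have "centers \<G> T \<in> center_sets (topspace (Euclidean_space n)) k"
    by (intro centers_in_center_sets)
  then show ?thesis using that dist_to_centers[OF small] \<G>(2) by blast
qed

section \<open>Coresets of the grid\<close>

lemma lowered_dist_powr_le:
  assumes "1 \<le> z"
  shows "lowered_dist powr z \<le> (1 - 1 / (4 * R)) * far_dist powr z"
proof -
  let ?q = "1 - 1 / (4 * R)"
  have q: "0 < ?q" "?q \<le> 1" using R_ge_1 by (auto simp: field_simps)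
  have "?q\<^sup>2 * (2 * R\<^sup>2 + 1 - R)
      = (2 * R\<^sup>2 + 1 - 2 * R) + (1 - 1 / R) / 2 + (2 * R\<^sup>2 + 1 - R) / (16 * R\<^sup>2)"
    using R_ge_1 by (simp add: field_simps power2_eq_square)
  moreover have "0 \<le> (1 - 1 / R) / 2" "0 \<le> (2 * R\<^sup>2 + 1 - R) / (16 * R\<^sup>2)"
    using R_ge_1 R_le_R_squared by auto
  ultimately have "2 * R\<^sup>2 + 1 - 2 * R \<le> ?q\<^sup>2 * (2 * R\<^sup>2 + 1 - R)" by linarith
  then have "lowered_dist \<le> sqrt (?q\<^sup>2 * (2 * R\<^sup>2 + 1 - R))"
    unfolding lowered_dist_def by (rule real_sqrt_le_mono)
  also have "\<dots> = ?q * far_dist"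
    unfolding far_dist_def real_sqrt_mult using q by simp
  finally have "lowered_dist \<le> ?q * far_dist" .
  then have "lowered_dist powr z \<le> (?q * far_dist) powr z"
    using assms R_ge_1 R_le_R_squared by (intro powr_mono2) (auto simp: lowered_dist_def)
  also have "\<dots> = ?q powr z * far_dist powr z" by (rule powr_mult)
  also have "?q powr z \<le> ?q powr 1" using q assms by (intro powr_mono') auto
  also have "?q powr 1 = ?q" using q by simp
  finally show ?thesis by (simp add: mult_right_mono)
qed

lemma R_powr_le_far_dist_powr:
  assumes "0 \<le> z"
  shows "R powr z \<le> far_dist powr z"
proof -
  have "R \<le> far_dist"
    unfolding far_dist_def using R_le_R_squared by (intro real_le_rsqrt) auto
  then show ?thesis using assms R_ge_1 by (intro powr_mono2) auto
qed

lemma grid_cost_eq: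
  assumes "\<And>p. p \<in> grid \<Longrightarrow> dist_to_set (euclid_dist n) (grid_point p) C = grid_dist U T p"
  shows "grid_cost z C = (\<Sum>p\<in>grid. grid_dist U T p powr z)"
  unfolding clustering_cost_def sum.reindex[OF inj_on_grid_point] o_def
  using assms by simp

lemma sum_grid_dist_powr_le:
  assumes U: "U \<subseteq> {..<m}" "real m \<le> real (card U) * far_dist powr z"
  shows "(\<Sum>p\<in>grid. grid_dist U {} p powr z) \<le> 2 * real (card U) * real s * far_dist powr z"
proof -
  have "(\<Sum>p\<in>grid. grid_dist U {} p powr z)
      \<le> (\<Sum>p\<in>grid. 1 + (if p \<in> U \<times> {..<s} then far_dist powr z else 0))"
    by (intro sum_mono) (auto simp: grid_dist_def grid_def)
  also have "\<dots> = real (card grid) + (\<Sum>p\<in>U \<times> {..<s}. far_dist powr z)"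
    unfolding sum.distrib using U(1) finite_grid
    by (intro arg_cong2[where f = "(+)"] sum.mono_neutral_cong_right) (auto simp: grid_def)
  also have "\<dots> = real s * real m + real (card U) * real s * far_dist powr z"
    by (simp add: grid_def card_cartesian_product)
  also have "\<dots> \<le> real s * (real (card U) * far_dist powr z) + real (card U) * real s * far_dist powr z"
    using U(2) by (intro add_right_mono mult_left_mono) auto
  finally show ?thesis by (simp add: mult_ac)
qed

lemma sum_grid_dist_powr_diff:
  assumes "T \<subseteq> U \<times> {..<s}" "U \<subseteq> {..<m}"
  shows "(\<Sum>p\<in>grid. grid_dist U {} p powr z) - (\<Sum>p\<in>grid. grid_dist U T p powr z)
    = real (card T) * (far_dist powr z - lowered_dist powr z)"
proof -
  have "(\<Sum>p\<in>grid. grid_dist U {} p powr z) - (\<Sum>p\<in>grid. grid_dist U T p powr z)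
      = (\<Sum>p\<in>grid. if p \<in> T then far_dist powr z - lowered_dist powr z else 0)"
    unfolding sum_subtractf[symmetric] using assms
    by (intro sum.cong) (auto simp: grid_dist_def)
  also have "\<dots> = (\<Sum>p\<in>T. far_dist powr z - lowered_dist powr z)"
    using assms finite_grid by (intro sum.mono_neutral_cong_right) (auto simp: grid_def)
  finally show ?thesis by simp
qed

lemma ex_center_sets_agreeing_on:
  assumes S: "S \<subseteq> grid" and z: "1 \<le> z"
    and U: "U \<subseteq> {..<m}" "real m \<le> real (card U) * R powr z"
    and budget: "real m + (real (card U) / R\<^sup>2 + 1) * real s \<le> real k"
  obtains C C' where "C \<in> center_sets (topspace (Euclidean_space n)) k"
    "C' \<in> center_sets (topspace (Euclidean_space n)) k"
    "\<forall>x\<in>grid_point ` S. dist_to_set (euclid_dist n) x C = dist_to_set (euclid_dist n) x C'"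
    "grid_cost z C \<le> 2 * real (card U) * real s * far_dist powr z"
    "real (card (U \<times> {..<s} - S)) * (far_dist powr z / (4 * R)) \<le> grid_cost z C - grid_cost z C'"
proof -
  define T where "T = U \<times> {..<s} - S"
  obtain C where C: "C \<in> center_sets (topspace (Euclidean_space n)) k"
      and dist_C: "\<And>p. p \<in> grid \<Longrightarrow> dist_to_set (euclid_dist n) (grid_point p) C = grid_dist U {} p"
    using ex_center_set_grid_dist[OF U(1) budget, of "{}"] by blast
  obtain C' where C': "C' \<in> center_sets (topspace (Euclidean_space n)) k"
      and dist_C': "\<And>p. p \<in> grid \<Longrightarrow> dist_to_set (euclid_dist n) (grid_point p) C' = grid_dist U T p"
    using ex_center_set_grid_dist[OF U(1) budget, of T] by blast
  have "real (card U) * R powr z \<le> real (card U) * far_dist powr z"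
    using z by (intro mult_left_mono R_powr_le_far_dist_powr) auto
  then have cost_C: "grid_cost z C \<le> 2 * real (card U) * real s * far_dist powr z"
    using sum_grid_dist_powr_le[of U z] U grid_cost_eq[OF dist_C] by simp
  have "real (card T) * (far_dist powr z / (4 * R))
      \<le> real (card T) * (far_dist powr z - lowered_dist powr z)"
    using lowered_dist_powr_le[OF z] by (intro mult_left_mono) (auto simp: algebra_simps)
  also have "\<dots> = grid_cost z C - grid_cost z C'"
    using sum_grid_dist_powr_diff[of T U z] U
    by (simp add: grid_cost_eq[OF dist_C] grid_cost_eq[OF dist_C'] T_def)
  finally have gap: "real (card T) * (far_dist powr z / (4 * R)) \<le> grid_cost z C - grid_cost z C'" .
  have "\<forall>x\<in>grid_point ` S. dist_to_set (euclid_dist n) x C = dist_to_set (euclid_dist n) x C'"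
    using S by (auto simp: dist_C dist_C' subset_iff grid_dist_def T_def)
  then show ?thesis using C C' cost_C gap unfolding T_def by (intro that)
qed

lemma card_missed_le:
  assumes cs: "is_coreset (topspace (Euclidean_space n)) (euclid_dist n) k z \<epsilon>
      (grid_point ` grid) (grid_point ` S) w"
    and S: "S \<subseteq> grid" and z: "1 \<le> z" and \<epsilon>: "0 \<le> \<epsilon>"
    and U: "U \<subseteq> {..<m}" "real m \<le> real (card U) * R powr z"
    and budget: "real m + (real (card U) / R\<^sup>2 + 1) * real s \<le> real k"
  shows "real (card (U \<times> {..<s} - S)) \<le> 16 * R * \<epsilon> * (real (card U) * real s)"
proof -
  let ?A = "far_dist powr z"
  obtain C C' where C: "C \<in> center_sets (topspace (Euclidean_space n)) k"
      "C' \<in> center_sets (topspace (Euclidean_space n)) k"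
    and same: "\<forall>x\<in>grid_point ` S. dist_to_set (euclid_dist n) x C = dist_to_set (euclid_dist n) x C'"
    and cost_C: "grid_cost z C \<le> 2 * real (card U) * real s * ?A"
    and gap: "real (card (U \<times> {..<s} - S)) * (?A / (4 * R)) \<le> grid_cost z C - grid_cost z C'"
    by (rule ex_center_sets_agreeing_on[OF S z U budget])
  note gap
  also have "grid_cost z C - grid_cost z C' \<le> 2 * \<epsilon> * grid_cost z C"
    using same by (intro coreset_cost_diff_le[OF cs C _ \<epsilon>]) blast
  also have "\<dots> \<le> 2 * \<epsilon> * (2 * real (card U) * real s * ?A)"
    using cost_C \<epsilon> by (intro mult_left_mono) auto
  finally have "real (card (U \<times> {..<s} - S)) * ?A \<le> (16 * R * \<epsilon> * (real (card U) * real s)) * ?A"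
    using R_ge_1 by (simp add: field_simps)
  moreover have "0 < ?A"
    using R_powr_le_far_dist_powr[of z] z R_ge_1 by (smt (verit) powr_gt_zero)
  ultimately show ?thesis by simp
qed

definition row_hits :: "(nat \<times> nat) set \<Rightarrow> nat \<Rightarrow> nat" where
  "row_hits S i = card {j. j < s \<and> (i, j) \<in> S}"

lemma sum_row_hits:
  assumes "finite U"
  shows "(\<Sum>i\<in>U. row_hits S i) = card (U \<times> {..<s} \<inter> S)"
proof -
  have "U \<times> {..<s} \<inter> S = (SIGMA i:U. {j. j < s \<and> (i, j) \<in> S})" by auto
  then show ?thesis using assms by (simp add: row_hits_def)
qed

lemma sum_row_hits_ge:
  assumes cs: "is_coreset (topspace (Euclidean_space n)) (euclid_dist n) k z \<epsilon>
      (grid_point ` grid) (grid_point ` S) w"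
    and S: "S \<subseteq> grid" and z: "1 \<le> z" and \<epsilon>: "0 \<le> \<epsilon>" "64 * R * \<epsilon> \<le> 1"
    and U: "U \<subseteq> {..<m}" "real m \<le> real (card U) * R powr z"
    and budget: "real m + (real (card U) / R\<^sup>2 + 1) * real s \<le> real k"
  shows "3 / 4 * real s * real (card U) \<le> (\<Sum>i\<in>U. real (row_hits S i))"
proof -
  have fin: "finite U" using U(1) finite_subset by blast
  have "real (card (U \<times> {..<s} - S)) \<le> (16 * R * \<epsilon>) * (real (card U) * real s)"
    by (rule card_missed_le[OF cs S z \<epsilon>(1) U budget])
  also have "\<dots> \<le> 1 / 4 * (real (card U) * real s)"
    using \<epsilon>(2) by (intro mult_right_mono) auto
  finally have "real (card (U \<times> {..<s} - S)) \<le> real (card U) * real s / 4" by simp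
  moreover have "card (U \<times> {..<s} \<inter> S) + card (U \<times> {..<s} - S) = card U * s"
    using fin card_Int_Diff[of "U \<times> {..<s}" S] by (simp add: card_cartesian_product)
  then have "real (card (U \<times> {..<s} \<inter> S)) + real (card (U \<times> {..<s} - S)) = real (card U) * real s"
    by (simp flip: of_nat_add of_nat_mult)
  ultimately show ?thesis
    using sum_row_hits[OF fin] by (simp add: mult_ac flip: of_nat_sum)
qed

lemma coreset_card_ge:
  assumes cs: "is_coreset (topspace (Euclidean_space n)) (euclid_dist n) k z \<epsilon>
      (grid_point ` grid) S w"
    and z: "1 \<le> z" and \<epsilon>: "0 \<le> \<epsilon>" "64 * R * \<epsilon> \<le> 1"
    and u: "real m \<le> real u * R powr z"
    and budget: "real m + (real u / R\<^sup>2 + 1) * real s \<le> real k"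
  shows "3 / 4 * (real s * (real m - real u)) \<le> real (card S)"
proof -
  have "S \<subseteq> grid_point ` grid" using cs by (simp add: is_coreset_def)
  then obtain S' where S': "S' \<subseteq> grid" "S = grid_point ` S'" by (meson subset_imageE)
  have "0 < u" using u rows_pos by (cases u) auto
  moreover have "3 / 4 * real s * real u \<le> (\<Sum>i\<in>U. real (row_hits S' i))"
    if "U \<subseteq> {..<m}" "card U = u" for U
    using sum_row_hits_ge[OF cs[unfolded S'(2)] S'(1) z \<epsilon> that(1)] u budget that(2) by simp
  ultimately have "3 / 4 * real s * (real (card {..<m}) - real u) \<le> (\<Sum>i<m. real (row_hits S' i))"
    by (intro sum_ge_if_subset_sums_ge) auto
  also have "\<dots> = real (card (grid \<inter> S'))"
    using sum_row_hits[of "{..<m}"] by (simp add: grid_def flip: of_nat_sum)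
  also have "grid \<inter> S' = S'" using S'(1) by blast
  also have "card S' = card S"
    unfolding S'(2) using card_image[OF inj_on_subset[OF inj_on_grid_point S'(1)]] by simp
  finally show ?thesis by simp
qed

end

section \<open>Hard instances\<close>

definition hard_instance :: "nat \<Rightarrow> nat \<Rightarrow> real \<Rightarrow> real \<Rightarrow> real \<Rightarrow> (nat \<Rightarrow> real) set \<Rightarrow> bool" where
  "hard_instance n k z \<epsilon> B P \<longleftrightarrow> finite P \<and> P \<subseteq> topspace (Euclidean_space n) \<and>
     (\<forall>S w. is_coreset (topspace (Euclidean_space n)) (euclid_dist n) k z \<epsilon> P S w \<longrightarrow>
       B \<le> real (card S))"

lemma hard_instance_mono: "hard_instance n k z \<epsilon> B P \<Longrightarrow> B' \<le> B \<Longrightarrow> hard_instance n k z \<epsilon> B' P"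
  unfolding hard_instance_def by (meson order_trans)

lemma infinite_topspace_Euclidean_space:
  assumes "0 < n"
  shows "infinite (topspace (Euclidean_space n))"
proof (rule infinite_super)
  let ?e = "\<lambda>(t::real) i. if i = (0::nat) then t else 0"
  show "range ?e \<subseteq> topspace (Euclidean_space n)"
    using assms by (auto simp: topspace_Euclidean_space)
  have "inj ?e" by (rule injI) (auto dest: fun_cong[where x = 0])
  then show "infinite (range ?e)"
    using infinite_UNIV_char_0 finite_imageD by blast
qed

lemma ex_hard_instance_any_eps:
  assumes "1 \<le> k" "0 < n" "\<epsilon> < 1"
  obtains P where "hard_instance n k z \<epsilon> (real k) P"
proof -
  obtain P where P: "finite P" "card P = Suc k" "P \<subseteq> topspace (Euclidean_space n)"
    using infinite_arbitrarily_large[OF infinite_topspace_Euclidean_space[OF assms(2)]] by blast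
  have "k < card S"
    if "is_coreset (topspace (Euclidean_space n)) (euclid_dist n) k z \<epsilon> P S w" for S w
    using Metric_space.coreset_card_gt[OF Metric_space_euclid_dist that P(1,3)] P(2) assms by simp
  then have "hard_instance n k z \<epsilon> (real k) P"
    using P by (force simp: hard_instance_def)
  then show ?thesis by (rule that)
qed

lemma ex_grid_parameters:
  fixes z R :: real and k :: nat
  assumes z: "1 \<le> z" and R: "2 \<le> R" and k: "64 * R powr (z + 2) \<le> real k"
  obtains m s u :: nat where "0 < m" "0 < s" "real m \<le> real u * R powr z"
    "real m + (real u / R\<^sup>2 + 1) * real s \<le> real k"
    "real k * R powr (z + 2) / 32 \<le> real s * (real m - real u)"
proof -
  define Q where "Q = R powr (z + 2)"
  define m where "m = k div 2"
  define s where "s = nat \<lfloor>Q / 2\<rfloor>"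
  define u where "u = nat \<lceil>real m / R powr z\<rceil>"
  have Q_eq: "Q = R powr z * R\<^sup>2" using R by (simp add: Q_def powr_add)
  have "R powr 1 \<le> R powr z" using R z by (intro powr_mono) auto
  then have Rz: "2 \<le> R powr z" using R by simp
  have R2: "4 \<le> R\<^sup>2" using R power_mono[of 2 R 2] by simp
  have Q: "8 \<le> Q" unfolding Q_eq using mult_mono[of 2 "R powr z" 4 "R\<^sup>2"] Rz R2 by simp
  have Qk: "64 * Q \<le> real k" using k by (simp add: Q_def)
  have m: "real k / 2 - 1 / 2 \<le> real m" "real m \<le> real k / 2"
    unfolding m_def by linarith+
  have s: "Q / 4 \<le> real s" "real s \<le> Q / 2"
    using Q unfolding s_def by linarith+
  have u: "real m / R powr z \<le> real u" "real u \<le> real m / R powr z + 1"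
    unfolding u_def by (auto simp: of_nat_nat)
  have "real u / R\<^sup>2 \<le> (real m / R powr z + 1) / R\<^sup>2"
    using u(2) by (intro divide_right_mono) auto
  also have "\<dots> = real m / Q + 1 / R\<^sup>2" by (simp add: Q_eq add_divide_distrib)
  also have "\<dots> \<le> real m / Q + 1" using R2 by (simp add: divide_le_eq)
  finally have "(real u / R\<^sup>2 + 1) * real s \<le> (real m / Q + 2) * (Q / 2)"
    using s Q by (intro mult_mono) auto
  also have "\<dots> = real m / 2 + Q" using Q by (simp add: field_simps)
  finally have budget: "real m + (real u / R\<^sup>2 + 1) * real s \<le> real k"
    using m(2) Qk Q by linarith
  have "real m / R powr z \<le> real m / 2" using Rz by (intro divide_left_mono) auto
  then have "real k / 8 \<le> real m - real u" using u(2) m Qk Q by linarith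
  then have "(Q / 4) * (real k / 8) \<le> real s * (real m - real u)"
    using s Q by (intro mult_mono) auto
  then have rows_left: "real k * R powr (z + 2) / 32 \<le> real s * (real m - real u)"
    by (simp add: Q_def mult_ac)
  have "real m \<le> real u * R powr z" using u(1) R by (simp add: pos_divide_le_eq)
  moreover have "0 < real m" "0 < real s" using m s Qk Q by linarith+
  ultimately show ?thesis using budget rows_left by (intro that) auto
qed

lemma ex_hard_instance_small_eps:
  assumes z: "1 \<le> z" and \<epsilon>: "0 < \<epsilon>" "\<epsilon> \<le> 1 / 128"
    and k: "64 * (1 / (64 * \<epsilon>)) powr (z + 2) \<le> real k" and n: "k < n"
  obtains P where "hard_instance n k z \<epsilon> (real k * (1 / (64 * \<epsilon>)) powr (z + 2) / 64) P"
proof -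
  define R where "R = 1 / (64 * \<epsilon>)"
  have R: "2 \<le> R" "64 * R * \<epsilon> \<le> 1" using \<epsilon> by (auto simp: R_def field_simps)
  obtain m s u :: nat where pos: "0 < m" "0 < s" and u: "real m \<le> real u * R powr z"
    and budget: "real m + (real u / R\<^sup>2 + 1) * real s \<le> real k"
    and large: "real k * R powr (z + 2) / 32 \<le> real s * (real m - real u)"
    using ex_grid_parameters[OF z R(1)] k unfolding R_def by blast
  have "1 * real s \<le> (real u / R\<^sup>2 + 1) * real s"
    by (intro mult_right_mono) auto
  then have "real (m + s) < real n" using budget n by linarith
  then interpret grid_instance R m s n
    using R pos by unfold_locales auto
  have "real k * R powr (z + 2) / 64 \<le> real (card S)"
    if cs: "is_coreset (topspace (Euclidean_space n)) (euclid_dist n) k z \<epsilon> (grid_point ` grid) S w"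
    for S w
  proof -
    have "3 / 4 * (real s * (real m - real u)) \<le> real (card S)"
      using coreset_card_ge[OF cs z _ R(2) u budget] \<epsilon>(1) by simp
    moreover have "0 \<le> real k * R powr (z + 2)" by simp
    ultimately show ?thesis using large by linarith
  qed
  then have "hard_instance n k z \<epsilon> (real k * R powr (z + 2) / 64) (grid_point ` grid)"
    unfolding hard_instance_def using finite_grid grid_point_in_space by blast
  then show ?thesis unfolding R_def by (rule that)
qed

lemma ex_hard_instance:
  assumes z: "1 \<le> z" and k: "1 \<le> k" "k < n" and \<epsilon>: "0 < \<epsilon>" "\<epsilon> < 1"
    and k_large: "(1 / \<epsilon>) powr (z + 2) \<le> real k"
  obtains P where "hard_instance n k z \<epsilon> (real k * (1 / (128 * \<epsilon>)) powr (z + 2) / 64) P"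
proof (cases "\<epsilon> \<le> 1 / 128")
  case True
  let ?R = "1 / (64 * \<epsilon>)"
  have "64 * ?R powr (z + 2) \<le> 64 powr (z + 2) * ?R powr (z + 2)"
    using z powr_mono[of 1 "z + 2" 64] by (intro mult_right_mono) auto
  also have "\<dots> = (1 / \<epsilon>) powr (z + 2)" by (simp flip: powr_mult)
  finally have "64 * ?R powr (z + 2) \<le> real k" using k_large by linarith
  then obtain P where P: "hard_instance n k z \<epsilon> (real k * ?R powr (z + 2) / 64) P"
    by (rule ex_hard_instance_small_eps[OF z \<epsilon>(1) True _ k(2)])
  have "(1 / (128 * \<epsilon>)) powr (z + 2) \<le> ?R powr (z + 2)"
    using z \<epsilon> by (intro powr_mono2) (auto simp: field_simps)
  then have "real k * (1 / (128 * \<epsilon>)) powr (z + 2) / 64 \<le> real k * ?R powr (z + 2) / 64"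
    by (intro divide_right_mono mult_left_mono) auto
  then show ?thesis by (rule that[OF hard_instance_mono[OF P]])
next
  case False
  obtain P where P: "hard_instance n k z \<epsilon> (real k) P"
    using ex_hard_instance_any_eps[of k n \<epsilon> z] k \<epsilon> by auto
  have "(1 / (128 * \<epsilon>)) powr (z + 2) \<le> 1"
    using False \<epsilon> z by (intro powr_le1) auto
  then have "real k * (1 / (128 * \<epsilon>)) powr (z + 2) \<le> real k * 1"
    by (intro mult_left_mono) auto
  then have "real k * (1 / (128 * \<epsilon>)) powr (z + 2) / 64 \<le> real k" by simp
  then show ?thesis by (rule that[OF hard_instance_mono[OF P]])
qed

lemma inverse_powr_le:
  fixes k \<epsilon> p :: real
  assumes "0 < k" "0 < p" "k powr (- 1 / p) \<le> \<epsilon>"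
  shows "(1 / \<epsilon>) powr p \<le> k"
proof -
  have "(1 / \<epsilon>) powr p = \<epsilon> powr (- p)" by (simp add: powr_divide powr_minus_divide)
  also have "\<dots> \<le> (k powr (- 1 / p)) powr (- p)"
    using assms by (intro powr_mono2') auto
  also have "\<dots> = k" using assms by (simp add: powr_powr)
  finally show ?thesis .
qed

lemma ex_hard_instance_large_dimension:
  assumes z: "1 \<le> z" and k: "1 \<le> k" and \<epsilon>: "0 < \<epsilon>" "\<epsilon> < 1" "real k powr (- 1 / (z + 2)) \<le> \<epsilon>"
  shows "\<exists>n P. real k * \<epsilon> powr (- z) \<le> real n \<and>
    hard_instance n k z \<epsilon> ((1 / 128) powr (z + 2) / 64 * (real k * \<epsilon> powr (- z - 2))) P"
proof -
  define n where "n = k + nat \<lceil>real k * \<epsilon> powr (- z)\<rceil> + 1"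
  have n: "k < n" "real k * \<epsilon> powr (- z) \<le> real n"
    unfolding n_def by linarith+
  have "(1 / \<epsilon>) powr (z + 2) \<le> real k"
    using z k \<epsilon> by (intro inverse_powr_le) auto
  then obtain P where "hard_instance n k z \<epsilon> (real k * (1 / (128 * \<epsilon>)) powr (z + 2) / 64) P"
    by (rule ex_hard_instance[OF z k n(1) \<epsilon>(1,2)])
  moreover have "(1 / (128 * \<epsilon>)) powr (z + 2) = (1 / 128) powr (z + 2) * (1 / \<epsilon>) powr (z + 2)"
    by (simp flip: powr_mult)
  moreover have "(1 / \<epsilon>) powr (z + 2) = \<epsilon> powr (- z - 2)"
    using powr_minus_divide[of \<epsilon> "z + 2"] by (simp add: powr_divide)
  ultimately show ?thesis using n(2) by (auto simp: mult_ac)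
qed

theorem theorem1p1:
  shows "\<exists>c::real. c > 0 \<and>
    (\<forall>z::real. z \<ge> 1 \<longrightarrow>
      (\<exists>a b::real. a > 0 \<and> b > 0 \<and>
        (\<forall>(k::nat) (\<epsilon>::real).
          k \<ge> 1 \<and> 0 < \<epsilon> \<and> \<epsilon> < 1 \<and> \<epsilon> \<ge> c * real k powr (- 1 / (z + 2)) \<longrightarrow>
          (\<exists>(n::nat) (P :: (nat \<Rightarrow> real) set).
            real n \<ge> a * (real k * \<epsilon> powr (- z)) \<and>
            finite P \<and> P \<subseteq> topspace (Euclidean_space n) \<and>
            (\<forall>S w. is_coreset (topspace (Euclidean_space n)) (euclid_dist n) k z \<epsilon> P S w \<longrightarrow>
              real (card S) \<ge> b * (real k * \<epsilon> powr (- z - 2)))))))"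
proof -
  have "\<exists>a b::real. a > 0 \<and> b > 0 \<and>
      (\<forall>(k::nat) (\<epsilon>::real).
        k \<ge> 1 \<and> 0 < \<epsilon> \<and> \<epsilon> < 1 \<and> \<epsilon> \<ge> 1 * real k powr (- 1 / (z + 2)) \<longrightarrow>
        (\<exists>n P. real n \<ge> a * (real k * \<epsilon> powr (- z)) \<and>
          hard_instance n k z \<epsilon> (b * (real k * \<epsilon> powr (- z - 2))) P))"
    if "z \<ge> 1" for z :: real
    using ex_hard_instance_large_dimension[OF that]
    by (intro exI[of _ 1] exI[of _ "(1 / 128) powr (z + 2) / 64"]) simp
  then show ?thesis
    unfolding hard_instance_def by (intro exI[of _ 1]) simp
qed

end
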